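(* Fix the action set $\mathsf{A}$, the communication function $\gamma$, and the parameters $S$, $(\mathit{sched}_n)_{n\ge1}$, $(\mathit{update}_n)_{n\ge1}$, $C$, $D$, $\mathit{cr}$ of the theory $\mathrm{siACP}^{\epsilon}$ described in the context (the same $\mathsf{A}$ and $\gamma$ being used for $\mathrm{ACP}^{\epsilon}$). For each guarded recursive specification $E$ over $\mathrm{siACP}^{\epsilon}$ and each $X\in\mathrm{vars}(E)$, there exists a guarded recursive specification $E'$ over $\mathrm{ACP}^{\epsilon}$ such that the equation $\langle X\mid E\rangle=\langle X\mid E'\rangle$ is derivable from the axioms of $\mathrm{siACP}^{\epsilon}_{\mathrm{rec}}$.
   Context: \textbf{ACP$^{\epsilon}$.} Fix a set $\mathsf{A}$ of actions with $\delta,\epsilon\notin\mathsf{A}$; write $\mathsf{A}_\delta=\mathsf{A}\cup\{\delta\}$. Fix a commutative and associative communication function $\gamma:\mathsf{A}_\delta\times\mathsf{A}_\delta\to\mathsf{A}_\delta$ with $\gamma(\delta,a)=\delta$ for all $a$. The signature of $\mathrm{ACP}^{\epsilon}$ has constants $\delta$ (inaction), $\epsilon$ (empty process), and $a$ for each $a\in\mathsf{A}$; binary operators $+$ (alternative composition), $\cdot$ (sequential composition), $\parallel$ (parallel composition), $\mathbin{\lfloor\!\lfloor}$ (left merge), $\mid$ (communication merge); and unary $\partial_H$ (encapsulation) for each $H\subseteq\mathsf{A}$. Its axioms are the following, where $x,y,z$ are variables, $a,b$ range over constants other than $\epsilon$ (i.e. $\delta$ and action constants), $H\subseteq \mathsf{A}$,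 and $\gamma(a,b)$ denotes the corresponding constant: A1 $x+y=y+x$; A2 $(x+y)+z=x+(y+z)$; A3 $x+x=x$; A4 $(x+y)\cdot z=x\cdot z+y\cdot z$; A5 $(x\cdot y)\cdot z=x\cdot(y\cdot z)$; A6 $x+\delta=x$; A7 $\delta\cdot x=\delta$; A8 $x\cdot\epsilon=x$; A9 $\epsilon\cdot x=x$; D0 $\partial_H(\epsilon)=\epsilon$; D1 $\partial_H(a)=a$ if $a\notin H$; D2 $\partial_H(a)=\delta$ if $a\in H$; D3 $\partial_H(x+y)=\partial_H(x)+\partial_H(y)$; D4 $\partial_H(x\cdot y)=\partial_H(x)\cdot\partial_H(y)$; CM1T $x\parallel y=x\mathbin{\lfloor\!\lfloor}y+y\mathbin{\lfloor\!\lfloor}x+x\mid y+\partial_{\mathsf{A}}(x)\cdot\partial_{\mathsf{A}}(y)$; CM2T $\epsilon\mathbin{\lfloor\!\lfloor}x=\delta$; CM3 $a\cdot x\mathbin{\lfloor\!\lfloor}y=a\cdot(x\parallel y)$; CM4 $(x+y)\mathbin{\lfloor\!\lfloor}z=x\mathbin{\lfloor\!\lfloor}z+y\mathbin{\lfloor\!\lfloor}z$; CM5T $\epsilon\mid x=\delta$; CM6T $x\mid\epsilon=\delta$; CM7 $a\cdot x\mid b\cdot y=\gamma(a,b)\cdot(x\parallel y)$; CM8 $(x+y)\mid z=x\mid z+y\mid z$; CM9 $x\mid(y+z)=x\mid y+x\mid z$; CM10 $a\mid b=\gamma(a,b)$; CM11 $\delta\mid x=\delta$; CM12 $x\mid\delta=\delta$.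 ($\cdot$ binds strongest, $+$ weakest.) \textbf{Interleaving histories.} The set $\mathcal{H}\subseteq(\mathbb{N}^+\times\mathbb{N}^+)^*$ is inductively defined by: the empty sequence is in $\mathcal{H}$; if $i\le n$ then the one-element sequence $\langle i,n\rangle\in\mathcal{H}$; if $h\frown\langle i,n\rangle\in\mathcal{H}$, $j\le n$ and $n-1\le m\le n+1$, then $h\frown\langle i,n\rangle\frown\langle j,m\rangle\in\mathcal{H}$ ($\frown$ is concatenation). \textbf{siACP$^{\epsilon}$.} Fix: a set $S$ of control states; for each $n\in\mathbb{N}^+$ a partial function $\mathit{sched}_n:\mathcal{H}\times S\rightharpoonup\{1,\dots,n\}$ and a total function $\mathit{update}_n:\mathcal{H}\times S\times\{1,\dots,n\}\times(\mathsf{A}\cup\{\epsilon\})\to S$; a set $C\subset\mathsf{A}$ of control actions such that for each $c\in C$ there is an action $\overline{c}\in\mathsf{A}\setminus C$, and for all $a,b\in\mathsf{A}$, $c\in C$: $\gamma(a,b)\neq c$, $\gamma(a,b)\ne\overline c$, $\gamma(a,c)=\delta$, $\gamma(a,\overline c)=\delta$; a finite or countably infinite set $D$ of data, with actions $\mathrm{pcr}(d),\mathrm{rcr}(d)\in\mathsf{A}\setminus(C\cup\{\overline c: c\in C\})$ for $d\in D$ such that for all $a,b\in\mathsf{A}$: $\gamma(a,b)\ne\mathrm{pcr}(d)$, $\gamma(a,b)\neq\mathrm{rcr}(d)$, $\gamma(a,\mathrm{pcr}(d))=\delta$, $\gamma(a,\mathrm{rcr}(d))=\delta$; and a function $\mathit{cr}:D\to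 P$ where $P$ is the set of closed terms over the signature of $\mathrm{siACP}^{\epsilon}$. The signature of $\mathrm{siACP}^{\epsilon}$ is that of $\mathrm{ACP}^{\epsilon}$ plus: an $n$-ary strategic interleaving operator $\Vert^n_{h,s}$ for each $n\in\mathbb{N}^+$, $h\in\mathcal{H}$, $s\in S$; and an $n$-ary positional strategic interleaving operator $\Vert^{n,i}_{h,s}$ for each $n,i\in\mathbb{N}^+$ with $i\le n$, $h\in\mathcal{H}$, $s\in S$. Its axioms are those of $\mathrm{ACP}^{\epsilon}$ plus the following (for all such $n,i,h,s$; $a$ ranges over action constants $a\in\mathsf{A}$ not of the form $\mathrm{pcr}(d)$ or $\mathrm{rcr}(d)$; $d\in D$): SI0 $\Vert^n_{h,s}(x_1,\dots,x_n)=\delta$ if $\mathit{sched}_n(h,s)$ is undefined; SI1 $\Vert^n_{h,s}(x_1,\dots,x_n)=\Vert^{n,\mathit{sched}_n(h,s)}_{h,s}(x_1,\dots,x_n)$ if $\mathit{sched}_n(h,s)$ is defined; SI2 $\Vert^{n,i}_{h,s}(x_1,\dots,x_{i-1},\delta,x_{i+1},\dots,x_n)=\delta$; SI3T $\Vert^{1,i}_{h,s}(\epsilon)=\epsilon$; SI4T $\Vert^{n+1,i}_{h,s}(x_1,\dots,x_{i-1},\epsilon,x_{i+1},\dots,x_{n+1})=\Vert^{n}_{h\frown\langle i,n\rangle,\ \mathit{update}_{n+1}(h,s,i,\epsilon)}(x_1,\dots,x_{i-1},x_{i+1},\dots,x_{n+1})$; SI5Ta $\Vert^{n,i}_{h,s}(x_1,\dots,x_{i-1},a\cdot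 x_i',x_{i+1},\dots,x_n)=a\cdot\Vert^{n}_{h\frown\langle i,n\rangle,\ \mathit{update}_n(h,s,i,a)}(x_1,\dots,x_{i-1},x_i',x_{i+1},\dots,x_n)$ if $a\notin C$; SI5Tb the same with right-hand side starting with $\overline a\cdot$ instead of $a\cdot$, if $a\in C$; SI7 $\Vert^{n,i}_{h,s}(x_1,\dots,x_{i-1},\mathrm{pcr}(d)\cdot x_i',x_{i+1},\dots,x_n)=\mathrm{rcr}(d)\cdot\Vert^{n+1}_{h\frown\langle i,n+1\rangle,\ \mathit{update}_n(h,s,i,\mathrm{pcr}(d))}(x_1,\dots,x_{i-1},x_i',x_{i+1},\dots,x_n,\mathit{cr}(d))$; SI8 $\Vert^{n,i}_{h,s}(\dots,x_i'+x_i'',\dots)=\Vert^{n,i}_{h,s}(\dots,x_i',\dots)+\Vert^{n,i}_{h,s}(\dots,x_i'',\dots)$ (other arguments unchanged). \textbf{Guarded recursion.} Let $T$ be $\mathrm{ACP}^{\epsilon}$ or $\mathrm{siACP}^{\epsilon}$. An occurrence of a variable $X$ in a $T$ term $t$ is guarded if $t$ has a subterm $a\cdot t'$ with $a\in\mathsf{A}$ and $t'$ containing that occurrence; $t$ is guarded if all variable occurrences in it are guarded. A guarded recursive specification over $T$ is a set $E=\{X_i=t_i\mid i\in I\}$ with $I$ finite or countably infinite, the $X_i$ pairwise distinct variables, and each $t_i$ either a guarded $T$ term containing no variables other than the $X_j$, or a $T$ term rewritable to such a term using the axioms of $T$ in either direction and/or the equations $X_j=t_j$ ($j\neq i$) from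 left to right. $\mathrm{vars}(E)$ is the set of variables occurring in $E$. $T_{\mathrm{rec}}$ extends $T$ with a constant $\langle X\mid E\rangle$ for each such $E$ and $X\in\mathrm{vars}(E)$, and axioms RDP: $\langle X\mid E\rangle=\langle t\mid E\rangle$ for each equation $X=t$ in $E$ (where $\langle t\mid E\rangle$ is $t$ with every $Y\in\mathrm{vars}(E)$ replaced by $\langle Y\mid E\rangle$), and RSP: $E\Rightarrow X=\langle X\mid E\rangle$ for $X\in\mathrm{vars}(E)$. Derivations use infinitary conditional equational logic.
   Formalization: An axiom letting an active rcr(d) act like an ordinary action (as in SI5Ta) is added; histories range over a superset of H closed under the extensions in SI4T, SI5T, SI7; each right-hand side t_i contains only the variables X_j. *)

theory Defs
  imports Main "HOL-Library.Countable_Set"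
begin

section \<open>Terms\<close>

text \<open>
  The type \<open>'a\<close> is the set of actions. The constants other than the empty process,
  i.e. \<open>\<delta>\<close> and the action constants, are kept apart in the type \<open>'a adelta\<close>, since the
  communication function and several axiom schemas range over exactly these. The last argument
  of the update functions ranges over the actions and \<open>\<epsilon>\<close>, hence \<open>'a aeps\<close>.
\<close>

datatype 'a adelta = Delta | Act 'a

datatype 'a aeps = Empty | Done 'a

text \<open>There are countably many variables, so every recursive specification is countable.\<close>

type_synonym var = nat

type_synonym history = "(nat \<times> nat) list"

text \<open>
  \<open>SInt h s [x\<^sub>1, \<dots>, x\<^sub>n]\<close> and \<open>PInt i h s [x\<^sub>1, \<dots>, x\<^sub>n]\<close> are the \<open>n\<close>-ary strategic and
  positional strategic interleaving operators; \<open>n\<close> is the length of the list.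
  \<open>Rec X E\<close> is the constant \<open>\<langle>X|E\<rangle>\<close>. A recursive specification is a partial map
  from variables to right-hand sides, which makes the left-hand sides pairwise distinct.
  Which raw terms belong to the signature of which theory is fixed by \<open>in_sig\<close> below.
\<close>

datatype ('a, 's) trm =
    Var var
  | Eps
  | Con "'a adelta"
  | Alt "('a, 's) trm" "('a, 's) trm"
  | Seq "('a, 's) trm" "('a, 's) trm"
  | Par "('a, 's) trm" "('a, 's) trm"
  | LMerge "('a, 's) trm" "('a, 's) trm"
  | CMerge "('a, 's) trm" "('a, 's) trm"
  | Encap "'a set" "('a, 's) trm"
  | SInt history 's "('a, 's) trm list"
  | PInt nat history 's "('a, 's) trm list"
  | Rec var "var \<Rightarrow> ('a, 's) trm option"

type_synonym ('a, 's) rspec = "var \<Rightarrow> ('a, 's) trm option"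

abbreviation Dlt :: "('a, 's) trm" where
  "Dlt \<equiv> Con Delta"

abbreviation Ac :: "'a \<Rightarrow> ('a, 's) trm" where
  "Ac a \<equiv> Con (Act a)"

fun vars :: "('a, 's) trm \<Rightarrow> var set" where
  "vars (Var X) = {X}"
| "vars Eps = {}"
| "vars (Con c) = {}"
| "vars (Alt x y) = vars x \<union> vars y"
| "vars (Seq x y) = vars x \<union> vars y"
| "vars (Par x y) = vars x \<union> vars y"
| "vars (LMerge x y) = vars x \<union> vars y"
| "vars (CMerge x y) = vars x \<union> vars y"
| "vars (Encap H x) = vars x"
| "vars (SInt h s xs) = (\<Union>x\<in>set xs. vars x)"
| "vars (PInt i h s xs) = (\<Union>x\<in>set xs. vars x)"
| "vars (Rec X E) = {}"

fun subst :: "(var \<Rightarrow> ('a, 's) trm) \<Rightarrow> ('a, 's) trm \<Rightarrow> ('a, 's) trm" where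
  "subst \<sigma> (Var X) = \<sigma> X"
| "subst \<sigma> Eps = Eps"
| "subst \<sigma> (Con c) = Con c"
| "subst \<sigma> (Alt x y) = Alt (subst \<sigma> x) (subst \<sigma> y)"
| "subst \<sigma> (Seq x y) = Seq (subst \<sigma> x) (subst \<sigma> y)"
| "subst \<sigma> (Par x y) = Par (subst \<sigma> x) (subst \<sigma> y)"
| "subst \<sigma> (LMerge x y) = LMerge (subst \<sigma> x) (subst \<sigma> y)"
| "subst \<sigma> (CMerge x y) = CMerge (subst \<sigma> x) (subst \<sigma> y)"
| "subst \<sigma> (Encap H x) = Encap H (subst \<sigma> x)"
| "subst \<sigma> (SInt h s xs) = SInt h s (map (subst \<sigma>) xs)"
| "subst \<sigma> (PInt i h s xs) = PInt i h s (map (subst \<sigma>) xs)"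
| "subst \<sigma> (Rec X E) = Rec X E"

text \<open>
  The variables with at least one occurrence that is not inside the \<open>t'\<close> of a subterm
  \<open>a \<cdot> t'\<close> with \<open>a\<close> an action.
\<close>

fun unguarded_vars :: "('a, 's) trm \<Rightarrow> var set" where
  "unguarded_vars (Var X) = {X}"
| "unguarded_vars Eps = {}"
| "unguarded_vars (Con c) = {}"
| "unguarded_vars (Alt x y) = unguarded_vars x \<union> unguarded_vars y"
| "unguarded_vars (Seq x y) =
     (if \<exists>a. x = Ac a then {} else unguarded_vars x \<union> unguarded_vars y)"
| "unguarded_vars (Par x y) = unguarded_vars x \<union> unguarded_vars y"
| "unguarded_vars (LMerge x y) = unguarded_vars x \<union> unguarded_vars y"
| "unguarded_vars (CMerge x y) = unguarded_vars x \<union> unguarded_vars y"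
| "unguarded_vars (Encap H x) = unguarded_vars x"
| "unguarded_vars (SInt h s xs) = (\<Union>x\<in>set xs. unguarded_vars x)"
| "unguarded_vars (PInt i h s xs) = (\<Union>x\<in>set xs. unguarded_vars x)"
| "unguarded_vars (Rec X E) = {}"

definition guarded :: "('a, 's) trm \<Rightarrow> bool" where
  "guarded t \<longleftrightarrow> unguarded_vars t = {}"

text \<open>One-hole contexts, represented by the functions that fill the hole.\<close>

inductive ctxt :: "(('a, 's) trm \<Rightarrow> ('a, 's) trm) \<Rightarrow> bool" where
  hole: "ctxt (\<lambda>x. x)"
| alt_l: "ctxt c \<Longrightarrow> ctxt (\<lambda>x. Alt (c x) t)"
| alt_r: "ctxt c \<Longrightarrow> ctxt (\<lambda>x. Alt t (c x))"
| seq_l: "ctxt c \<Longrightarrow> ctxt (\<lambda>x. Seq (c x) t)"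
| seq_r: "ctxt c \<Longrightarrow> ctxt (\<lambda>x. Seq t (c x))"
| par_l: "ctxt c \<Longrightarrow> ctxt (\<lambda>x. Par (c x) t)"
| par_r: "ctxt c \<Longrightarrow> ctxt (\<lambda>x. Par t (c x))"
| lmerge_l: "ctxt c \<Longrightarrow> ctxt (\<lambda>x. LMerge (c x) t)"
| lmerge_r: "ctxt c \<Longrightarrow> ctxt (\<lambda>x. LMerge t (c x))"
| cmerge_l: "ctxt c \<Longrightarrow> ctxt (\<lambda>x. CMerge (c x) t)"
| cmerge_r: "ctxt c \<Longrightarrow> ctxt (\<lambda>x. CMerge t (c x))"
| encap: "ctxt c \<Longrightarrow> ctxt (\<lambda>x. Encap H (c x))"
| sint: "ctxt c \<Longrightarrow> ctxt (\<lambda>x. SInt h s (us @ c x # vs))"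
| pint: "ctxt c \<Longrightarrow> ctxt (\<lambda>x. PInt i h s (us @ c x # vs))"


section \<open>Interleaving histories\<close>

inductive_set hist :: "history set" where
  nil: "[] \<in> hist"
| single: "1 \<le> i \<Longrightarrow> i \<le> n \<Longrightarrow> [(i, n)] \<in> hist"
| snoc: "h @ [(i, n)] \<in> hist \<Longrightarrow> 1 \<le> j \<Longrightarrow> j \<le> n \<Longrightarrow> 1 \<le> m \<Longrightarrow> n \<le> m + 1 \<Longrightarrow> m \<le> n + 1
    \<Longrightarrow> h @ [(i, n), (j, m)] \<in> hist"

text \<open>
  The operators are available for every arity \<open>n\<close> together with every history \<open>h\<close>, and the
  right-hand sides of SI4T, SI5Ta, SI5Tb and SI7 are indexed by \<open>h\<close> extended with a further pair.
  Such an extension need not be in \<open>hist\<close>: from \<open>[]\<close>, termination of the second of two processes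
  leads to \<open>[(2, 1)]\<close>. For these axioms to be equations over the signature, histories are taken
  from the least superset of \<open>hist\<close> that is closed under the extensions occurring in them
  (pairs \<open>(i, n)\<close> and \<open>(i, n + 1)\<close> for \<open>i \<le> n\<close>, and \<open>(i, n)\<close> for \<open>i \<le> n + 1\<close>).
\<close>

inductive_set xhist :: "history set" where
  base: "h \<in> hist \<Longrightarrow> h \<in> xhist"
| extend: "h \<in> xhist \<Longrightarrow> 1 \<le> n \<Longrightarrow> 1 \<le> i \<Longrightarrow> i \<le> n + 1 \<Longrightarrow> h @ [(i, n)] \<in> xhist"


section \<open>Signatures and parameters\<close>

datatype theory_name = ACP | SI_ACP

text \<open>
  \<open>K\<close> is the set of pairs \<open>(X, E)\<close> for which \<open>\<langle>X|E\<rangle>\<close> is a constant of the signature.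
\<close>

fun in_sig :: "theory_name \<Rightarrow> (var \<times> ('a, 's) rspec) set \<Rightarrow> ('a, 's) trm \<Rightarrow> bool" where
  "in_sig T K (Var X) \<longleftrightarrow> True"
| "in_sig T K Eps \<longleftrightarrow> True"
| "in_sig T K (Con c) \<longleftrightarrow> True"
| "in_sig T K (Alt x y) \<longleftrightarrow> in_sig T K x \<and> in_sig T K y"
| "in_sig T K (Seq x y) \<longleftrightarrow> in_sig T K x \<and> in_sig T K y"
| "in_sig T K (Par x y) \<longleftrightarrow> in_sig T K x \<and> in_sig T K y"
| "in_sig T K (LMerge x y) \<longleftrightarrow> in_sig T K x \<and> in_sig T K y"
| "in_sig T K (CMerge x y) \<longleftrightarrow> in_sig T K x \<and> in_sig T K y"
| "in_sig T K (Encap H x) \<longleftrightarrow> in_sig T K x"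
| "in_sig T K (SInt h s xs) \<longleftrightarrow>
     T = SI_ACP \<and> h \<in> xhist \<and> 1 \<le> length xs \<and> (\<forall>x\<in>set xs. in_sig T K x)"
| "in_sig T K (PInt i h s xs) \<longleftrightarrow>
     T = SI_ACP \<and> h \<in> xhist \<and> 1 \<le> i \<and> i \<le> length xs \<and> (\<forall>x\<in>set xs. in_sig T K x)"
| "in_sig T K (Rec X E) \<longleftrightarrow> (X, E) \<in> K"

abbreviation is_term :: "theory_name \<Rightarrow> ('a, 's) trm \<Rightarrow> bool" where
  "is_term T \<equiv> in_sig T {}"

text \<open>The type \<open>'s\<close> is the set of control states; \<open>cbar c\<close> matters for \<open>c \<in> ctrl\<close> only.\<close>

record ('a, 's, 'd) params =
  comm :: "'a adelta \<Rightarrow> 'a adelta \<Rightarrow> 'a adelta"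
  sched :: "nat \<Rightarrow> history \<Rightarrow> 's \<Rightarrow> nat option"
  upd :: "nat \<Rightarrow> history \<Rightarrow> 's \<Rightarrow> nat \<Rightarrow> 'a aeps \<Rightarrow> 's"
  ctrl :: "'a set"
  cbar :: "'a \<Rightarrow> 'a"
  data :: "'d set"
  pcr :: "'d \<Rightarrow> 'a"
  rcr :: "'d \<Rightarrow> 'a"
  cr :: "'d \<Rightarrow> ('a, 's) trm"

definition acp_params :: "('a, 's, 'd) params \<Rightarrow> bool" where
  "acp_params P \<longleftrightarrow>
     (\<forall>a b. comm P a b = comm P b a) \<and>
     (\<forall>a b c. comm P (comm P a b) c = comm P a (comm P b c)) \<and>
     (\<forall>a. comm P Delta a = Delta)"

definition siacp_params :: "('a, 's, 'd) params \<Rightarrow> bool" where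
  "siacp_params P \<longleftrightarrow>
     acp_params P \<and>
     (\<forall>n h s i. 1 \<le> n \<longrightarrow> h \<in> xhist \<longrightarrow> sched P n h s = Some i \<longrightarrow> 1 \<le> i \<and> i \<le> n) \<and>
     ctrl P \<subset> UNIV \<and>
     (\<forall>c\<in>ctrl P. cbar P c \<notin> ctrl P) \<and>
     (\<forall>a b. \<forall>c\<in>ctrl P.
        comm P (Act a) (Act b) \<noteq> Act c \<and> comm P (Act a) (Act b) \<noteq> Act (cbar P c) \<and>
        comm P (Act a) (Act c) = Delta \<and> comm P (Act a) (Act (cbar P c)) = Delta) \<and>
     countable (data P) \<and>
     (\<forall>d\<in>data P. pcr P d \<notin> ctrl P \<union> cbar P ` ctrl P \<and> rcr P d \<notin> ctrl P \<union> cbar P ` ctrl P) \<and>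
     (\<forall>a b. \<forall>d\<in>data P.
        comm P (Act a) (Act b) \<noteq> Act (pcr P d) \<and> comm P (Act a) (Act b) \<noteq> Act (rcr P d) \<and>
        comm P (Act a) (Act (pcr P d)) = Delta \<and> comm P (Act a) (Act (rcr P d)) = Delta) \<and>
     (\<forall>d\<in>data P. is_term SI_ACP (cr P d) \<and> vars (cr P d) = {})"


section \<open>Axioms\<close>

text \<open>
  The axioms are given by all their substitution instances. Constants \<open>a\<close>, \<open>b\<close> of type
  \<open>'a adelta\<close> include \<open>\<delta>\<close>.
\<close>

inductive acp_ax :: "('a, 's, 'd) params \<Rightarrow> ('a, 's) trm \<Rightarrow> ('a, 's) trm \<Rightarrow> bool"
  for P where
  A1: "acp_ax P (Alt x y) (Alt y x)"
| A2: "acp_ax P (Alt (Alt x y) z) (Alt x (Alt y z))"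
| A3: "acp_ax P (Alt x x) x"
| A4: "acp_ax P (Seq (Alt x y) z) (Alt (Seq x z) (Seq y z))"
| A5: "acp_ax P (Seq (Seq x y) z) (Seq x (Seq y z))"
| A6: "acp_ax P (Alt x Dlt) x"
| A7: "acp_ax P (Seq Dlt x) Dlt"
| A8: "acp_ax P (Seq x Eps) x"
| A9: "acp_ax P (Seq Eps x) x"
| D0: "acp_ax P (Encap H Eps) Eps"
| D1: "a \<notin> Act ` H \<Longrightarrow> acp_ax P (Encap H (Con a)) (Con a)"
| D2: "a \<in> Act ` H \<Longrightarrow> acp_ax P (Encap H (Con a)) Dlt"
| D3: "acp_ax P (Encap H (Alt x y)) (Alt (Encap H x) (Encap H y))"
| D4: "acp_ax P (Encap H (Seq x y)) (Seq (Encap H x) (Encap H y))"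
| CM1T: "acp_ax P (Par x y)
    (Alt (Alt (Alt (LMerge x y) (LMerge y x)) (CMerge x y)) (Seq (Encap UNIV x) (Encap UNIV y)))"
| CM2T: "acp_ax P (LMerge Eps x) Dlt"
| CM3: "acp_ax P (LMerge (Seq (Con a) x) y) (Seq (Con a) (Par x y))"
| CM4: "acp_ax P (LMerge (Alt x y) z) (Alt (LMerge x z) (LMerge y z))"
| CM5T: "acp_ax P (CMerge Eps x) Dlt"
| CM6T: "acp_ax P (CMerge x Eps) Dlt"
| CM7: "acp_ax P (CMerge (Seq (Con a) x) (Seq (Con b) y)) (Seq (Con (comm P a b)) (Par x y))"
| CM8: "acp_ax P (CMerge (Alt x y) z) (Alt (CMerge x z) (CMerge y z))"
| CM9: "acp_ax P (CMerge x (Alt y z)) (Alt (CMerge x y) (CMerge x z))"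
| CM10: "acp_ax P (CMerge (Con a) (Con b)) (Con (comm P a b))"
| CM11: "acp_ax P (CMerge Dlt x) Dlt"
| CM12: "acp_ax P (CMerge x Dlt) Dlt"

text \<open>
  An argument list is written \<open>us @ x # vs\<close>; then \<open>x\<close> is the argument at position
  \<open>Suc (length us)\<close>.

  Without SI5R no axiom applies to a positional interleaving whose active argument is
  \<open>rcr(d) \<cdot> x\<close>, although such arguments arise already when an interleaving with process
  creation is nested in another one. A term like \<open>PInt 1 [] s [rcr(d)]\<close> could then be modelled
  both as \<open>\<delta>\<close> and as an \<open>rcr(d)\<close>-step without affecting the other axioms, so it would not be
  provably equal to any process defined over ACP. SI5R treats \<open>rcr(d)\<close> like the ordinary
  actions of SI5Ta.
\<close>

inductive si_ax :: "('a, 's, 'd) params \<Rightarrow> ('a, 's) trm \<Rightarrow> ('a, 's) trm \<Rightarrow> bool"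
  for P where
  SI0: "sched P (length xs) h s = None \<Longrightarrow> si_ax P (SInt h s xs) Dlt"
| SI1: "sched P (length xs) h s = Some i \<Longrightarrow> si_ax P (SInt h s xs) (PInt i h s xs)"
| SI2: "i = Suc (length us) \<Longrightarrow> si_ax P (PInt i h s (us @ Dlt # vs)) Dlt"
| SI3T: "si_ax P (PInt 1 h s [Eps]) Eps"
| SI4T: "i = Suc (length us) \<Longrightarrow> n = length (us @ vs) \<Longrightarrow> 1 \<le> n \<Longrightarrow>
    si_ax P (PInt i h s (us @ Eps # vs))
      (SInt (h @ [(i, n)]) (upd P (n + 1) h s i Empty) (us @ vs))"
| SI5Ta: "i = Suc (length us) \<Longrightarrow> n = length (us @ x # vs) \<Longrightarrow>
    a \<notin> pcr P ` data P \<union> rcr P ` data P \<Longrightarrow> a \<notin> ctrl P \<Longrightarrow>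
    si_ax P (PInt i h s (us @ Seq (Ac a) x # vs))
      (Seq (Ac a) (SInt (h @ [(i, n)]) (upd P n h s i (Done a)) (us @ x # vs)))"
| SI5Tb: "i = Suc (length us) \<Longrightarrow> n = length (us @ x # vs) \<Longrightarrow>
    a \<notin> pcr P ` data P \<union> rcr P ` data P \<Longrightarrow> a \<in> ctrl P \<Longrightarrow>
    si_ax P (PInt i h s (us @ Seq (Ac a) x # vs))
      (Seq (Ac (cbar P a)) (SInt (h @ [(i, n)]) (upd P n h s i (Done a)) (us @ x # vs)))"
| SI5R: "i = Suc (length us) \<Longrightarrow> n = length (us @ x # vs) \<Longrightarrow>
    a \<in> rcr P ` data P \<Longrightarrow> a \<notin> pcr P ` data P \<Longrightarrow>
    si_ax P (PInt i h s (us @ Seq (Ac a) x # vs))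
      (Seq (Ac a) (SInt (h @ [(i, n)]) (upd P n h s i (Done a)) (us @ x # vs)))"
| SI7: "i = Suc (length us) \<Longrightarrow> n = length (us @ x # vs) \<Longrightarrow> d \<in> data P \<Longrightarrow>
    si_ax P (PInt i h s (us @ Seq (Ac (pcr P d)) x # vs))
      (Seq (Ac (rcr P d))
        (SInt (h @ [(i, n + 1)]) (upd P n h s i (Done (pcr P d))) (us @ x # vs @ [cr P d])))"
| SI8: "i = Suc (length us) \<Longrightarrow>
    si_ax P (PInt i h s (us @ Alt x y # vs))
      (Alt (PInt i h s (us @ x # vs)) (PInt i h s (us @ y # vs)))"

definition axiom_of ::
    "('a, 's, 'd) params \<Rightarrow> theory_name \<Rightarrow> ('a, 's) trm \<Rightarrow> ('a, 's) trm \<Rightarrow> bool" where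
  "axiom_of P T l r \<longleftrightarrow> acp_ax P l r \<or> (T = SI_ACP \<and> si_ax P l r)"


section \<open>Guarded recursion\<close>

definition spec_vars :: "('a, 's) rspec \<Rightarrow> var set" where
  "spec_vars E = dom E \<union> (\<Union>t\<in>ran E. vars t)"

text \<open>One rewrite step on the right-hand side of the equation for \<open>X\<close> in \<open>E\<close>.\<close>

inductive rewrite_step ::
    "('a, 's, 'd) params \<Rightarrow> theory_name \<Rightarrow> ('a, 's) rspec \<Rightarrow> var \<Rightarrow>
     ('a, 's) trm \<Rightarrow> ('a, 's) trm \<Rightarrow> bool"
  for P T E X where
  forward: "ctxt c \<Longrightarrow> axiom_of P T l r \<Longrightarrow> is_term T (c l) \<Longrightarrow> is_term T (c r)
    \<Longrightarrow> rewrite_step P T E X (c l) (c r)"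
| backward: "ctxt c \<Longrightarrow> axiom_of P T l r \<Longrightarrow> is_term T (c l) \<Longrightarrow> is_term T (c r)
    \<Longrightarrow> rewrite_step P T E X (c r) (c l)"
| equation: "ctxt c \<Longrightarrow> E Y = Some t \<Longrightarrow> Y \<noteq> X \<Longrightarrow> is_term T (c (Var Y)) \<Longrightarrow> is_term T (c t)
    \<Longrightarrow> rewrite_step P T E X (c (Var Y)) (c t)"

text \<open>
  Zero rewrite steps cover right-hand sides that are guarded themselves. All right-hand sides
  contain only variables for which there is an equation, so \<open>spec_vars E = dom E\<close>. Were
  \<open>E = {X = a + \<delta> \<cdot> Y}\<close> allowed, then RSP would make \<open>\<langle>Y|E\<rangle>\<close> equal to every term.
\<close>

definition guarded_spec ::
    "('a, 's, 'd) params \<Rightarrow> theory_name \<Rightarrow> ('a, 's) rspec \<Rightarrow> bool" where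
  "guarded_spec P T E \<longleftrightarrow>
     (\<forall>X t. E X = Some t \<longrightarrow>
        is_term T t \<and> vars t \<subseteq> dom E \<and>
        (\<exists>g. (rewrite_step P T E X)\<^sup>*\<^sup>* t g \<and> is_term T g \<and> guarded g \<and> vars g \<subseteq> dom E))"

definition is_rec_term :: "('a, 's, 'd) params \<Rightarrow> theory_name \<Rightarrow> ('a, 's) trm \<Rightarrow> bool" where
  "is_rec_term P T = in_sig T {(X, E). guarded_spec P T E \<and> X \<in> spec_vars E}"

definition inst :: "('a, 's) rspec \<Rightarrow> ('a, 's) trm \<Rightarrow> ('a, 's) trm" where
  "inst E = subst (\<lambda>Y. if Y \<in> spec_vars E then Rec Y E else Var Y)"

text \<open>
  Derivability of equations between terms of \<open>T\<close> with recursion in infinitary conditional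
  equational logic. RSP has one premise for each equation of \<open>E\<close>, possibly infinitely many.
\<close>

inductive derivable ::
    "('a, 's, 'd) params \<Rightarrow> theory_name \<Rightarrow> ('a, 's) trm \<Rightarrow> ('a, 's) trm \<Rightarrow> bool"
  for P T where
  refl: "is_rec_term P T x \<Longrightarrow> derivable P T x x"
| sym: "derivable P T x y \<Longrightarrow> derivable P T y x"
| trans: "derivable P T x y \<Longrightarrow> derivable P T y z \<Longrightarrow> derivable P T x z"
| cong: "derivable P T x y \<Longrightarrow> ctxt c \<Longrightarrow> is_rec_term P T (c x) \<Longrightarrow> is_rec_term P T (c y)
    \<Longrightarrow> derivable P T (c x) (c y)"
| ax: "axiom_of P T l r \<Longrightarrow> is_rec_term P T l \<Longrightarrow> is_rec_term P T r \<Longrightarrow> derivable P T l r"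
| RDP: "guarded_spec P T E \<Longrightarrow> E X = Some t \<Longrightarrow> derivable P T (Rec X E) (inst E t)"
| RSP: "guarded_spec P T E \<Longrightarrow> X \<in> spec_vars E \<Longrightarrow> (\<And>Y. is_rec_term P T (\<sigma> Y)) \<Longrightarrow>
    (\<And>Y t. E Y = Some t \<Longrightarrow> derivable P T (\<sigma> Y) (subst \<sigma> t)) \<Longrightarrow> derivable P T (\<sigma> X) (Rec X E)"

end

theory Submission
  imports Defs "HOL-Combinatorics.Transposition"
begin

text \<open>
  Every closed term over the constants \<open>\<langle>Y|E\<rangle>\<close> is provably equal to a head normal form, a finite
  sum of terms \<open>\<epsilon>\<close> and \<open>a \<cdot> t\<close> with \<open>t\<close> again closed: the axioms push every operator
  through such sums, and an RDP step followed by the rewriting to a guarded right-hand side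
  handles the constants \<open>\<langle>Y|E\<rangle>\<close>. Since a head normal form has finitely many targets \<open>t\<close>, only
  countably many closed terms are reached from \<open>\<langle>X|E\<rangle>\<close>. Taking one variable for each
  of them turns their head normal forms into a linear, hence guarded, specification over ACP, and
  the reached terms themselves solve it, so that RSP applies.
\<close>

section \<open>Substitution and derivability\<close>

lemma in_sig_mono:
  assumes "in_sig T K t" and "K \<subseteq> K'"
  shows "in_sig T K' t"
  using assms by (induction T K t rule: in_sig.induct) auto

lemma in_sig_subst:
  assumes "in_sig T K t" and "\<And>Y. Y \<in> vars t \<Longrightarrow> in_sig T K (\<sigma> Y)"
  shows "in_sig T K (subst \<sigma> t)"
  using assms by (induction t) auto

lemma vars_subst: "vars (subst \<sigma> t) = (\<Union>Y\<in>vars t. vars (\<sigma> Y))"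
  by (induction t) auto

lemma subst_id:
  assumes "\<And>Y. Y \<in> vars t \<Longrightarrow> \<sigma> Y = Var Y"
  shows "subst \<sigma> t = t"
  using assms by (induction t) (auto intro!: map_idI)

lemma acp_ax_subst:
  assumes "acp_ax P l r"
  shows "acp_ax P (subst \<sigma> l) (subst \<sigma> r)"
  using assms by cases (auto intro: acp_ax.intros)

text \<open>The schemas range over arbitrary arguments, so their instances are closed under
  substitution. The exception to check is SI7, whose right-hand side contains the fixed term
  \<open>cr P d\<close>; being closed, it is left unchanged.\<close>

lemma si_ax_subst:
  assumes "si_ax P l r" and "\<And>d. d \<in> data P \<Longrightarrow> vars (cr P d) = {}"
  shows "si_ax P (subst \<sigma> l) (subst \<sigma> r)"
proof -
  have cr: "subst \<sigma> (cr P d) = cr P d" if "d \<in> data P" for d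
    using assms(2)[OF that] by (intro subst_id) simp
  show ?thesis
    using assms(1)
  proof cases
    case (SI3T h s)
    then show ?thesis using si_ax.SI3T by simp
  next
    case (SI4T i us n vs h s)
    then show ?thesis
      using si_ax.SI4T[of i "map (subst \<sigma>) us" n "map (subst \<sigma>) vs" P h s] by simp
  qed (auto simp: cr intro: si_ax.intros[simplified])
qed

lemma is_rec_subst:
  assumes "is_rec_term P T t" and "\<And>Y. is_rec_term P T (\<sigma> Y)"
  shows "is_rec_term P T (subst \<sigma> t)"
  using assms unfolding is_rec_term_def by (auto intro: in_sig_subst)

lemma is_term_is_rec: "is_term T t \<Longrightarrow> is_rec_term P T t"
  unfolding is_rec_term_def by (erule in_sig_mono) simp

lemma is_rec_inst:
  assumes "is_term T t" and "guarded_spec P T E"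
  shows "is_rec_term P T (inst E t)"
  unfolding inst_def
  by (rule is_rec_subst[OF is_term_is_rec[OF assms(1)]]) (simp add: is_rec_term_def assms(2))

lemma guarded_specD:
  assumes "guarded_spec P T E" and "E X = Some t"
  shows "is_term T t" and "vars t \<subseteq> dom E"
    and "\<exists>g. (rewrite_step P T E X)\<^sup>*\<^sup>* t g \<and> is_term T g \<and> guarded g \<and> vars g \<subseteq> dom E"
  using assms unfolding guarded_spec_def by blast+

lemma spec_vars_guarded: "guarded_spec P T E \<Longrightarrow> spec_vars E = dom E"
  unfolding spec_vars_def guarded_spec_def by (fastforce simp: ran_def)

text \<open>Supplies the membership conditions that \<open>derivable.cong\<close> demands at every
  use.\<close>

lemma derivable_is_rec:
  assumes "derivable P T x y"
  shows "is_rec_term P T x \<and> is_rec_term P T y"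
  using assms
proof induction
  case (RDP E X t)
  then show ?case
    using is_rec_inst[OF guarded_specD(1)[OF RDP] RDP(1)]
    by (auto simp: is_rec_term_def spec_vars_def)
next
  case (RSP E X \<sigma>)
  then show ?case by (simp add: is_rec_term_def)
qed auto

lemma derivable_Alt:
  assumes "derivable P T x x'" and "derivable P T y y'"
  shows "derivable P T (Alt x y) (Alt x' y')"
proof (rule derivable.trans)
  show "derivable P T (Alt x y) (Alt x' y)"
    using derivable.cong[OF assms(1) ctxt.alt_l[OF ctxt.hole]] derivable_is_rec[OF assms(1)]
      derivable_is_rec[OF assms(2)] by (simp add: is_rec_term_def)
  show "derivable P T (Alt x' y) (Alt x' y')"
    using derivable.cong[OF assms(2) ctxt.alt_r[OF ctxt.hole]] derivable_is_rec[OF assms(1)]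
      derivable_is_rec[OF assms(2)] by (simp add: is_rec_term_def)
qed

lemma ctxt_in_sig:
  assumes "ctxt c" and "in_sig T K (c x)"
  shows "in_sig T K x"
  using assms by induction auto

text \<open>The substitution also acts on the siblings of the hole, so the context itself changes.
  Peeling off one operator at a time leaves a one-layer context with substituted siblings, to which
  congruence applies directly.\<close>

lemma derivable_subst_ctxt:
  assumes "ctxt c" and "derivable P T (subst \<sigma> x) (subst \<sigma> y)"
    and "is_rec_term P T (subst \<sigma> (c x))" and "is_rec_term P T (subst \<sigma> (c y))"
  shows "derivable P T (subst \<sigma> (c x)) (subst \<sigma> (c y))"
  using assms
proof induction
  case (sint c h s us vs)
  then show ?case
    using derivable.cong[OF _ ctxt.sint[OF ctxt.hole],
        of P T "subst \<sigma> (c x)" "subst \<sigma> (c y)" h s "map (subst \<sigma>) us" "map (subst \<sigma>) vs"]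
    by (auto simp: is_rec_term_def)
next
  case (pint c i h s us vs)
  then show ?case
    using derivable.cong[OF _ ctxt.pint[OF ctxt.hole],
        of P T "subst \<sigma> (c x)" "subst \<sigma> (c y)" i h s "map (subst \<sigma>) us" "map (subst \<sigma>) vs"]
    by (auto simp: is_rec_term_def)
qed (simp_all add: is_rec_term_def derivable.cong[OF _ ctxt.alt_l[OF ctxt.hole]]
    derivable.cong[OF _ ctxt.alt_r[OF ctxt.hole]] derivable.cong[OF _ ctxt.seq_l[OF ctxt.hole]]
    derivable.cong[OF _ ctxt.seq_r[OF ctxt.hole]] derivable.cong[OF _ ctxt.par_l[OF ctxt.hole]]
    derivable.cong[OF _ ctxt.par_r[OF ctxt.hole]] derivable.cong[OF _ ctxt.lmerge_l[OF ctxt.hole]]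
    derivable.cong[OF _ ctxt.lmerge_r[OF ctxt.hole]]
    derivable.cong[OF _ ctxt.cmerge_l[OF ctxt.hole]]
    derivable.cong[OF _ ctxt.cmerge_r[OF ctxt.hole]]
    derivable.cong[OF _ ctxt.encap[OF ctxt.hole]])

text \<open>Rewriting takes place on open terms, derivations are needed on their instances. Under
  \<open>inst E\<close> an axiom instance remains an axiom instance, and replacing \<open>Y\<close>
  by its right-hand side becomes an application of RDP.\<close>

lemma derivable_rewrite_step:
  assumes "rewrite_step P T E X t u" and "guarded_spec P T E"
    and "\<And>d. d \<in> data P \<Longrightarrow> vars (cr P d) = {}"
  shows "derivable P T (inst E t) (inst E u)"
proof -
  have ax: "axiom_of P T (inst E l) (inst E r)" if "axiom_of P T l r" for l r
    using that assms(3) acp_ax_subst si_ax_subst unfolding axiom_of_def inst_def by blast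
  have rec: "is_rec_term P T (inst E v)" if "is_term T v" for v
    using is_rec_inst[OF that assms(2)] .
  have cong: "derivable P T (inst E (c l)) (inst E (c r))"
    if "ctxt c" "is_term T (c l)" "is_term T (c r)" "derivable P T (inst E l) (inst E r)" for c l r
    using derivable_subst_ctxt[OF that(1)] that(4) rec[OF that(2)] rec[OF that(3)]
    unfolding inst_def by blast
  have ax_step: "derivable P T (inst E (c l)) (inst E (c r))"
    if "ctxt c" "is_term T (c l)" "is_term T (c r)" "axiom_of P T l r" for c l r
    using cong[OF that(1-3)] derivable.ax[OF ax[OF that(4)]] rec ctxt_in_sig that(1-3) by blast
  show ?thesis
    using assms(1)
  proof cases
    case (forward c l r)
    then show ?thesis using ax_step by simp
  next
    case (backward c l r)
    then show ?thesis using ax_step derivable.sym by blast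
  next
    case (equation c Y r)
    have "inst E (Var Y) = Rec Y E"
      using equation by (auto simp: inst_def spec_vars_def)
    then show ?thesis
      using cong[of c "Var Y" r] equation derivable.RDP[OF assms(2)] by simp
  qed
qed

section \<open>Head normal forms\<close>

text \<open>A bare action is not a head normal form; A8 turns it into the prefix
  \<open>Seq (Ac a) Eps\<close>, so every summand with a step has a target. \<open>Dlt\<close>
  serves as the empty sum.\<close>

inductive hnf :: "(('a, 's) trm \<Rightarrow> bool) \<Rightarrow> ('a, 's) trm \<Rightarrow> bool" for C where
  Dlt: "hnf C Dlt"
| Eps: "hnf C Eps"
| Pre: "C t \<Longrightarrow> hnf C (Seq (Ac a) t)"
| Alt: "hnf C x \<Longrightarrow> hnf C y \<Longrightarrow> hnf C (Alt x y)"

fun targets :: "('a, 's) trm \<Rightarrow> ('a, 's) trm set" where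
  "targets (Alt x y) = targets x \<union> targets y"
| "targets (Seq x t) = {t}"
| "targets _ = {}"

text \<open>On head normal forms the first argument of \<open>Seq\<close> is always an action, so
  the new variables are all guarded.\<close>

fun rename_targets :: "(('a, 's) trm \<Rightarrow> var) \<Rightarrow> ('a, 's) trm \<Rightarrow> ('a, 's) trm" where
  "rename_targets f (Alt x y) = Alt (rename_targets f x) (rename_targets f y)"
| "rename_targets f (Seq x t) = Seq x (Var (f t))"
| "rename_targets f t = t"

lemma finite_targets: "finite (targets t)"
  by (induction t) auto

lemma hnf_targets: "hnf C u \<Longrightarrow> t \<in> targets u \<Longrightarrow> C t"
  by (induction rule: hnf.induct) auto

lemma hnf_rename_targets:
  assumes "hnf C u"
  shows "is_term T (rename_targets f u)" and "guarded (rename_targets f u)"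
    and "vars (rename_targets f u) = f ` targets u"
  using assms by (induction rule: hnf.induct) (auto simp: guarded_def)

lemma subst_rename_targets:
  assumes "hnf C u" and "\<And>t. t \<in> targets u \<Longrightarrow> \<sigma> (f t) = t"
  shows "subst \<sigma> (rename_targets f u) = u"
  using assms by (induction rule: hnf.induct) auto

locale si_spec =
  fixes P :: "('a, 's, 'd) params" and E :: "('a, 's) rspec"
  assumes params: "siacp_params P"
    and spec: "guarded_spec P SI_ACP E"
begin

definition closed :: "('a, 's) trm \<Rightarrow> bool" where
  "closed t \<longleftrightarrow> in_sig SI_ACP {(X, F). F = E \<and> X \<in> dom E} t \<and> vars t = {}"

definition headed :: "('a, 's) trm \<Rightarrow> bool" where
  "headed t \<longleftrightarrow> closed t \<and> (\<exists>u. hnf closed u \<and> derivable P SI_ACP t u)"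

lemma closed_simps [simp]:
  "closed Eps" "closed (Con c)"
  "closed (Alt x y) \<longleftrightarrow> closed x \<and> closed y"
  "closed (Seq x y) \<longleftrightarrow> closed x \<and> closed y"
  "closed (Par x y) \<longleftrightarrow> closed x \<and> closed y"
  "closed (LMerge x y) \<longleftrightarrow> closed x \<and> closed y"
  "closed (CMerge x y) \<longleftrightarrow> closed x \<and> closed y"
  "closed (Encap H x) \<longleftrightarrow> closed x"
  "closed (SInt h s xs) \<longleftrightarrow> h \<in> xhist \<and> xs \<noteq> [] \<and> (\<forall>x\<in>set xs. closed x)"
  "closed (PInt i h s xs) \<longleftrightarrow>
     h \<in> xhist \<and> 1 \<le> i \<and> i \<le> length xs \<and> (\<forall>x\<in>set xs. closed x)"
  "closed (Rec X F) \<longleftrightarrow> F = E \<and> X \<in> dom E"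
  by (auto simp: closed_def Suc_le_eq)

lemma closed_is_rec: "closed t \<Longrightarrow> is_rec_term P SI_ACP t"
  unfolding closed_def is_rec_term_def
  using spec spec_vars_guarded[OF spec] by (auto elim!: in_sig_mono)

lemma closed_cr: "d \<in> data P \<Longrightarrow> closed (cr P d)"
  using params in_sig_mono[OF _ empty_subsetI] unfolding siacp_params_def closed_def by metis

lemma sched_range: "sched P n h s = Some i \<Longrightarrow> 1 \<le> n \<Longrightarrow> h \<in> xhist \<Longrightarrow> 1 \<le> i \<and> i \<le> n"
  using params unfolding siacp_params_def by blast

lemma hnf_closed: "hnf closed u \<Longrightarrow> closed u"
  by (induction rule: hnf.induct) auto

lemma headed_closed: "headed t \<Longrightarrow> closed t"
  by (simp add: headed_def)

lemma headed_hnf: "hnf closed u \<Longrightarrow> headed u"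
  unfolding headed_def using hnf_closed derivable.refl closed_is_rec by blast

lemma headed_derivable:
  assumes "derivable P SI_ACP t u" and "headed u" and "closed t"
  shows "headed t"
  using assms derivable.trans unfolding headed_def by blast

lemma headed_ax:
  assumes "axiom_of P SI_ACP t u" and "headed u" and "closed t"
  shows "headed t"
  using assms headed_derivable derivable.ax closed_is_rec headed_closed by blast

lemma headed_acp: "acp_ax P t u \<Longrightarrow> headed u \<Longrightarrow> closed t \<Longrightarrow> headed t"
  by (rule headed_ax) (simp_all add: axiom_of_def)

lemma headed_si: "si_ax P t u \<Longrightarrow> headed u \<Longrightarrow> closed t \<Longrightarrow> headed t"
  by (rule headed_ax) (simp_all add: axiom_of_def)

section \<open>Head normal forms under the operators of ACP\<close>

lemma headed_Dlt: "headed Dlt"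
  by (intro headed_hnf hnf.Dlt)

lemma headed_Eps: "headed Eps"
  by (intro headed_hnf hnf.Eps)

lemma headed_Pre: "closed t \<Longrightarrow> headed (Seq (Ac a) t)"
  by (intro headed_hnf hnf.Pre)

lemma headed_Seq_Con: "closed t \<Longrightarrow> headed (Seq (Con c) t)"
  by (cases c) (auto intro: headed_Pre headed_acp[OF A7] headed_Dlt)

lemma headed_Con: "headed (Con c)"
proof -
  have "derivable P SI_ACP (Con c) (Seq (Con c) Eps)"
    by (intro derivable.sym[OF derivable.ax] closed_is_rec) (auto simp: axiom_of_def intro: A8)
  then show ?thesis
    using headed_derivable headed_Seq_Con by simp
qed

lemma headed_Alt: "headed x \<Longrightarrow> headed y \<Longrightarrow> headed (Alt x y)"
  unfolding headed_def using derivable_Alt hnf.Alt closed_simps(3) by metis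

text \<open>Congruence replaces the argument in the hole by its head normal form. Each operator then
  needs only an induction over \<open>hnf\<close>, with one axiom per summand shape.\<close>

lemma headed_ctxt:
  assumes "ctxt c" and "headed x" and "closed (c x)"
    and "\<And>u. hnf closed u \<Longrightarrow> closed (c u) \<and> headed (c u)"
  shows "headed (c x)"
proof -
  obtain u where u: "hnf closed u" "derivable P SI_ACP x u"
    using assms(2) by (auto simp: headed_def)
  show ?thesis
    using headed_derivable[OF derivable.cong[OF u(2) assms(1)]] assms(3) assms(4)[OF u(1)]
      closed_is_rec by blast
qed

text \<open>The second factor needs a head as well, because A9 exposes it when the first one
  terminates.\<close>

lemma headed_Seq:
  assumes "headed x" and "headed y"
  shows "headed (Seq x y)"
proof (rule headed_ctxt[OF ctxt.seq_l[OF ctxt.hole]])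
  fix u assume "hnf closed u"
  then show "closed (Seq u y) \<and> headed (Seq u y)"
    using assms
  proof induction
    case Dlt
    then show ?case by (auto simp: headed_closed intro: headed_Seq_Con)
  next
    case Eps
    then show ?case by (auto simp: headed_closed intro: headed_acp[OF A9])
  next
    case (Pre t a)
    then show ?case by (auto simp: headed_closed intro!: headed_acp[OF A5] headed_Pre)
  next
    case (Alt x y)
    then show ?case by (auto simp: headed_closed intro: headed_acp[OF A4] headed_Alt)
  qed
qed (use assms headed_closed in auto)

lemma headed_Encap:
  assumes "headed x"
  shows "headed (Encap H x)"
proof (rule headed_ctxt[OF ctxt.encap[OF ctxt.hole]])
  have con: "headed (Encap H (Con c))" for c
    by (cases "c \<in> Act ` H") (auto intro: headed_acp[OF D1] headed_acp[OF D2] headed_Con)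
  fix u assume "hnf closed u"
  then show "closed (Encap H u) \<and> headed (Encap H u)"
  proof induction
    case Dlt
    then show ?case using con by simp
  next
    case Eps
    then show ?case by (auto intro: headed_acp[OF D0] headed_Eps)
  next
    case (Pre t a)
    \<comment> \<open>After D4 the encapsulated action stands in front and is evaluated in place by
      D1 or D2; blocking leaves \<open>Dlt\<close> in front, which A7 absorbs.\<close>
    have "headed (Seq (Encap H (Ac a)) (Encap H t))"
    proof (cases "a \<in> H")
      case True
      have "derivable P SI_ACP (Seq (Encap H (Ac a)) (Encap H t)) (Seq Dlt (Encap H t))"
        using Pre True
        by (intro derivable.cong[OF _ ctxt.seq_l[OF ctxt.hole]] derivable.ax closed_is_rec)
          (auto simp: axiom_of_def intro: D2)
      then show ?thesis using headed_derivable headed_Seq_Con Pre by simp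
    next
      case False
      have "derivable P SI_ACP (Seq (Encap H (Ac a)) (Encap H t)) (Seq (Ac a) (Encap H t))"
        using Pre False
        by (intro derivable.cong[OF _ ctxt.seq_l[OF ctxt.hole]] derivable.ax closed_is_rec)
          (auto simp: axiom_of_def intro: D1)
      then show ?thesis using headed_derivable headed_Seq_Con Pre by simp
    qed
    then show ?case using Pre by (auto intro: headed_acp[OF D4])
  next
    case (Alt x y)
    then show ?case by (auto intro: headed_acp[OF D3] headed_Alt)
  qed
qed (use assms headed_closed in auto)

text \<open>Closedness of \<open>y\<close> is enough: it survives only behind the first step of
  \<open>x\<close>, inside a target.\<close>

lemma headed_LMerge:
  assumes "headed x" and "closed y"
  shows "headed (LMerge x y)"
proof (rule headed_ctxt[OF ctxt.lmerge_l[OF ctxt.hole]])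
  fix u assume "hnf closed u"
  then show "closed (LMerge u y) \<and> headed (LMerge u y)"
    using assms(2)
  proof induction
    case Dlt
    \<comment> \<open>No axiom treats \<open>LMerge Dlt y\<close> directly; A8 read backwards gives
      \<open>Dlt\<close> the shape that CM3 expects, with \<delta> as its constant.\<close>
    have "derivable P SI_ACP (LMerge Dlt y) (LMerge (Seq Dlt Eps) y)"
      using Dlt
      by (intro derivable.cong[OF _ ctxt.lmerge_l[OF ctxt.hole]] derivable.sym[OF derivable.ax]
          closed_is_rec) (auto simp: axiom_of_def intro: A8)
    moreover have "headed (LMerge (Seq Dlt Eps) y)"
      using Dlt by (intro headed_acp[OF CM3]) (auto intro: headed_Seq_Con)
    ultimately show ?case using headed_derivable Dlt by simp
  next
    case Eps
    then show ?case by (auto intro: headed_acp[OF CM2T] headed_Dlt)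
  next
    case (Pre t a)
    then show ?case by (auto intro!: headed_acp[OF CM3] headed_Pre)
  next
    case (Alt x y)
    then show ?case by (auto intro: headed_acp[OF CM4] headed_Alt)
  qed
qed (use assms headed_closed in auto)

lemma headed_CMerge:
  assumes "headed x" and "headed y"
  shows "headed (CMerge x y)"
proof (rule headed_ctxt[OF ctxt.cmerge_l[OF ctxt.hole]])
  fix u assume "hnf closed u"
  then show "closed (CMerge u y) \<and> headed (CMerge u y)"
    using assms(2)
  proof induction
    case Dlt
    then show ?case by (auto simp: headed_closed intro: headed_acp[OF CM11] headed_Dlt)
  next
    case Eps
    then show ?case by (auto simp: headed_closed intro: headed_acp[OF CM5T] headed_Dlt)
  next
    case (Pre t a)
    \<comment> \<open>A prefix communicates only with a prefix, so the second argument needs its own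
      induction over head normal forms.\<close>
    have "headed (CMerge (Seq (Ac a) t) y)"
    proof (rule headed_ctxt[OF ctxt.cmerge_r[OF ctxt.hole]])
      fix v assume "hnf closed v"
      then show "closed (CMerge (Seq (Ac a) t) v) \<and> headed (CMerge (Seq (Ac a) t) v)"
        using \<open>closed t\<close>
      proof induction
        case Dlt
        then show ?case by (auto intro: headed_acp[OF CM12] headed_Dlt)
      next
        case Eps
        then show ?case by (auto intro: headed_acp[OF CM6T] headed_Dlt)
      next
        case (Pre t' b)
        then show ?case by (auto intro!: headed_acp[OF CM7] headed_Seq_Con)
      next
        case (Alt x y)
        then show ?case by (auto intro: headed_acp[OF CM9] headed_Alt)
      qed
    qed (use Pre headed_closed in auto)
    then show ?case using headed_closed by blast
  next
    case (Alt x y)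
    then show ?case by (auto simp: headed_closed intro: headed_acp[OF CM8] headed_Alt)
  qed
qed (use assms headed_closed in auto)

lemma headed_Par: "headed x \<Longrightarrow> headed y \<Longrightarrow> headed (Par x y)"
  by (rule headed_acp[OF CM1T])
    (simp_all add: headed_Alt headed_LMerge headed_CMerge headed_Seq headed_Encap headed_closed)

section \<open>Head normal forms under strategic interleaving\<close>

lemma headed_PInt_hnf:
  assumes "hnf closed u" and "h \<in> xhist" and i: "i = Suc (length us)"
    and cl: "\<forall>x\<in>set (us @ vs). closed x"
    and fewer: "\<And>h s. h \<in> xhist \<Longrightarrow> us @ vs \<noteq> [] \<Longrightarrow> headed (SInt h s (us @ vs))"
  shows "headed (PInt i h s (us @ u # vs))"
  using assms(1)
proof induction
  case Dlt
  then show ?case using assms by (auto intro: headed_si[OF SI2] headed_Dlt)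
next
  \<comment> \<open>Termination is the one case in which an interleaving reappears without an action
    in front, but with one argument fewer; hence the hypothesis on \<open>us @ vs\<close>.\<close>
  case Eps
  show ?case
  proof (cases "us @ vs = []")
    case True
    then show ?thesis using assms headed_si[OF SI3T] headed_Eps by simp
  next
    case False
    \<comment> \<open>The recorded arity is that after removal, so \<open>i\<close> may exceed it by
      one; \<open>xhist\<close> allows exactly this.\<close>
    then have "h @ [(i, length (us @ vs))] \<in> xhist"
      using assms(2) i by (intro xhist.extend) (auto simp: Suc_le_eq)
    then show ?thesis
      using assms False by (intro headed_si[OF SI4T]) (auto simp: Suc_le_eq)
  qed
next
  case (Pre t a)
  let ?n = "length (us @ t # vs)"
  have h1: "h @ [(i, ?n)] \<in> xhist" and h2: "h @ [(i, ?n + 1)] \<in> xhist"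
    using assms(2) i by (auto intro!: xhist.extend)
  have closed_lhs: "closed (PInt i h s (us @ Seq (Ac a) t # vs))"
    using Pre assms by auto
  \<comment> \<open>The values of \<open>pcr\<close> and \<open>rcr\<close> may overlap, so process
    creation is separated first, as the side conditions of SI5R require. In all four cases the new
    interleaving is behind an action and has only to be closed.\<close>
  consider (pcr) "a \<in> pcr P ` data P" | (rcr) "a \<in> rcr P ` data P" "a \<notin> pcr P ` data P"
    | (ctrl) "a \<notin> pcr P ` data P \<union> rcr P ` data P" "a \<in> ctrl P"
    | (plain) "a \<notin> pcr P ` data P \<union> rcr P ` data P" "a \<notin> ctrl P"
    by blast
  then show ?case
  proof cases
    case pcr
    then obtain d where d: "a = pcr P d" "d \<in> data P" by blast
    show ?thesis
      unfolding d(1)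
      by (rule headed_si[OF SI7[OF i HOL.refl d(2)] _ closed_lhs[unfolded d(1)]])
        (use h2 cl Pre closed_cr[OF d(2)] in \<open>auto intro!: headed_Pre\<close>)
  next
    case rcr
    show ?thesis
      by (rule headed_si[OF SI5R[OF i HOL.refl rcr] _ closed_lhs])
        (use h1 cl Pre in \<open>auto intro!: headed_Pre\<close>)
  next
    case ctrl
    show ?thesis
      by (rule headed_si[OF SI5Tb[OF i HOL.refl ctrl] _ closed_lhs])
        (use h1 cl Pre in \<open>auto intro!: headed_Pre\<close>)
  next
    case plain
    show ?thesis
      by (rule headed_si[OF SI5Ta[OF i HOL.refl plain] _ closed_lhs])
        (use h1 cl Pre in \<open>auto intro!: headed_Pre\<close>)
  qed
next
  case (Alt x y)
  then have "closed (PInt i h s (us @ Alt x y # vs))"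
    using assms hnf_closed by auto
  then show ?case
    using Alt by (auto intro: headed_si[OF SI8[OF i]] headed_Alt)
qed

lemma headed_PInt:
  assumes "headed x" and "h \<in> xhist" and "i = Suc (length us)"
    and "\<forall>x\<in>set (us @ vs). closed x"
    and "\<And>h s. h \<in> xhist \<Longrightarrow> us @ vs \<noteq> [] \<Longrightarrow> headed (SInt h s (us @ vs))"
  shows "headed (PInt i h s (us @ x # vs))"
proof (rule headed_ctxt[OF ctxt.pint[OF ctxt.hole]])
  fix u assume "hnf closed u"
  then show "closed (PInt i h s (us @ u # vs)) \<and> headed (PInt i h s (us @ u # vs))"
    using headed_PInt_hnf[OF _ assms(2-5)] headed_closed by blast
qed (use assms headed_closed in auto)

lemma split_at_position:
  assumes "1 \<le> i" and "i \<le> length xs"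
  obtains us x vs where "xs = us @ x # vs" and "i = Suc (length us)"
  using assms id_take_nth_drop[of "i - 1" xs]
  by (metis Suc_diff_1 Suc_le_lessD Suc_less_eq length_take less_Suc_eq_le less_imp_le min.absorb2
      One_nat_def)

text \<open>Induction on the number of arguments: scheduling leads to a positional interleaving,
  which calls for a smaller interleaving only on termination. Process creation does not disturb the
  measure, since the longer argument list lies in a target.\<close>

lemma headed_SInt:
  assumes "\<forall>x\<in>set xs. headed x" and "h \<in> xhist" and "xs \<noteq> []"
  shows "headed (SInt h s xs)"
  using assms
proof (induction "length xs" arbitrary: xs h s rule: less_induct)
  case less
  have closed_lhs: "closed (SInt h s xs)"
    using less.prems headed_closed by auto
  show ?case
  proof (cases "sched P (length xs) h s")
    case None
    show ?thesis by (rule headed_si[OF SI0[OF None] headed_Dlt closed_lhs])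
  next
    case (Some i)
    then have "1 \<le> i" "i \<le> length xs"
      using sched_range less.prems by (fastforce simp: Suc_le_eq)+
    then obtain us x vs where xs: "xs = us @ x # vs" "i = Suc (length us)"
      by (rule split_at_position)
    have "headed (PInt i h s (us @ x # vs))"
      using less.prems xs less.hyps[of "us @ vs"] headed_closed by (intro headed_PInt) auto
    then show ?thesis
      using headed_si[OF SI1[OF Some] _ closed_lhs] xs(1) by simp
  qed
qed

lemma headed_PInt_list:
  assumes "\<forall>x\<in>set xs. headed x" and "h \<in> xhist" and "1 \<le> i" and "i \<le> length xs"
  shows "headed (PInt i h s xs)"
proof -
  obtain us x vs where xs: "xs = us @ x # vs" "i = Suc (length us)"
    using split_at_position assms(3,4) by blast
  show ?thesis
    unfolding xs(1)
    using assms xs headed_SInt[of "us @ vs"] headed_closed by (intro headed_PInt) auto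
qed

section \<open>Head normal forms of guarded terms and recursion constants\<close>

lemma headed_subst:
  assumes "in_sig SI_ACP K t" and "\<And>Y F. (Y, F) \<in> K \<Longrightarrow> headed (Rec Y F)"
    and "\<And>Y. Y \<in> unguarded_vars t \<Longrightarrow> headed (\<sigma> Y)"
    and "\<And>Y. Y \<in> vars t \<Longrightarrow> closed (\<sigma> Y)"
  shows "headed (subst \<sigma> t)"
  using assms
proof (induction t)
  \<comment> \<open>Here guardedness enters: behind an action the rest has only to be closed, so
    guarded variables may receive terms not yet known to have a head. Otherwise the unguarded
    variables of both factors are unguarded in the product.\<close>
  case (Seq x y)
  have "closed (subst \<sigma> y)"
  proof -
    \<comment> \<open>A constant with a head is closed, so \<open>K\<close> contains only constants
      of \<open>E\<close>.\<close>
    have "in_sig SI_ACP {(X, F). F = E \<and> X \<in> dom E} y"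
      using Seq.prems(1) by (rule_tac in_sig_mono[of _ K]) (auto dest!: Seq.prems(2) headed_closed)
    then show ?thesis
      using Seq.prems(4) by (auto simp: closed_def vars_subst intro: in_sig_subst)
  qed
  then show ?case
    using Seq headed_Pre headed_Seq by (cases "\<exists>a. x = Ac a") auto
next
  case (SInt h s xs)
  then have "\<forall>x\<in>set xs. headed (subst \<sigma> x)" by fastforce
  then show ?case using SInt.prems(1) by (auto intro!: headed_SInt)
next
  case (PInt i h s xs)
  then have "\<forall>x\<in>set xs. headed (subst \<sigma> x)" by fastforce
  then show ?case using PInt.prems(1) by (auto intro!: headed_PInt_list)
qed (auto intro!: headed_Con headed_Eps headed_Alt headed_Par headed_LMerge headed_CMerge
    headed_Encap intro: headed_closed)

lemma headed_Rec:
  assumes "Y \<in> dom E"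
  shows "headed (Rec Y E)"
proof -
  have dom: "spec_vars E = dom E" by (rule spec_vars_guarded[OF spec])
  obtain t where t: "E Y = Some t" using assms by blast
  obtain g where g: "(rewrite_step P SI_ACP E Y)\<^sup>*\<^sup>* t g" "is_term SI_ACP g" "guarded g"
    "vars g \<subseteq> dom E"
    using guarded_specD(3)[OF spec t] by blast
  have cr: "\<And>d. d \<in> data P \<Longrightarrow> vars (cr P d) = {}"
    using params unfolding siacp_params_def by blast
  have "derivable P SI_ACP (Rec Y E) (inst E g)"
    using g(1)
  proof induction
    case base
    show ?case by (rule derivable.RDP[OF spec t])
  next
    case (step u v)
    then show ?case using derivable_rewrite_step[OF _ spec cr] derivable.trans by blast
  qed
  moreover have "headed (inst E g)"
    unfolding inst_def
    \<comment> \<open>There is no circularity: \<open>g\<close> has no unguarded variables and, with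
      \<open>K\<close> empty, no recursion constants, so no head of a constant is
      presupposed.\<close>
    by (rule headed_subst[OF g(2)]) (use g(3,4) dom in \<open>auto simp: guarded_def\<close>)
  ultimately show ?thesis
    using headed_derivable assms by simp
qed

text \<open>The recursion constants are now known to have heads, so \<open>headed_subst\<close>
  applies with them as \<open>K\<close> and the identity substitution.\<close>

lemma closed_headed:
  assumes "closed t"
  shows "headed t"
proof -
  have v: "vars t = {}" using assms by (simp add: closed_def)
  have "unguarded_vars t \<subseteq> vars t" by (induction t) auto
  then have "headed (subst Var t)"
    using assms headed_Rec v by (intro headed_subst) (auto simp: closed_def)
  then show ?thesis by (simp add: subst_id)
qed

section \<open>The countable linear specification over ACP\<close>

definition head :: "('a, 's) trm \<Rightarrow> ('a, 's) trm" where
  "head t = (SOME u. hnf closed u \<and> derivable P SI_ACP t u)"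

lemma head:
  assumes "closed t"
  shows "hnf closed (head t)" and "derivable P SI_ACP t (head t)"
  using closed_headed[OF assms] someI_ex[of "\<lambda>u. hnf closed u \<and> derivable P SI_ACP t u"]
  unfolding head_def headed_def by blast+

lemma acp_spec_exists:
  assumes "X \<in> dom E"
  shows "\<exists>E'. guarded_spec P ACP E' \<and> X \<in> spec_vars E' \<and>
    derivable P SI_ACP (Rec X E) (Rec X E')"
proof -
  \<comment> \<open>Having chosen one head normal form per term, \<open>step\<close> is a finitely
    branching transition relation on closed terms, and \<open>R\<close> is the set reachable from
    \<open>Rec X E\<close>.\<close>
  define step where "step = {(t, u). u \<in> targets (head t)}"
  define R where "R = step\<^sup>* `` {Rec X E}"
  have start: "Rec X E \<in> R" by (simp add: R_def)
  have succ: "targets (head t) \<subseteq> R" if "t \<in> R" for t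
    using that by (auto simp: R_def step_def intro: rtrancl_into_rtrancl)
  have closed_R: "closed t" if "t \<in> R" for t
  proof -
    have "(Rec X E, t) \<in> step\<^sup>*" using that by (simp add: R_def)
    then show ?thesis
      using assms by induction (auto simp: step_def intro: hnf_targets[OF head(1)])
  qed
  \<comment> \<open>Countability is what allows the reached terms to be named by variables, which
    are natural numbers.\<close>
  have "countable R"
    unfolding R_def
  proof (rule countable_rtrancl)
    fix Y :: "('a, 's) trm set"
    assume "countable Y"
    moreover have "step `` Y = (\<Union>t\<in>Y. targets (head t))" by (auto simp: step_def)
    ultimately show "countable (step `` Y)"
      by (auto intro: countable_finite finite_targets)
  qed simp
  then obtain e :: "('a, 's) trm \<Rightarrow> nat" where e: "inj_on e R"
    by (auto simp: countable_def)
  \<comment> \<open>The transposition renames the variables so that \<open>Rec X E\<close> receives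
    \<open>X\<close> itself, as the goal asks for the same variable on both sides.\<close>
  define f where "f = transpose (e (Rec X E)) X \<circ> e"
  have f: "inj_on f R" "f (Rec X E) = X"
    using e by (auto simp: f_def intro!: comp_inj_on inj_on_subset[OF inj_transpose])
  define E' where
    "E' Y = (if Y \<in> f ` R then Some (rename_targets f (head (inv_into R f Y))) else None)" for Y
  \<comment> \<open>RSP wants a term for every variable; outside the domain of \<open>E'\<close> the
    default \<open>Var Y\<close> is one.\<close>
  define \<sigma> where "\<sigma> Y = (if Y \<in> f ` R then inv_into R f Y else Var Y)" for Y
  have \<sigma>_f: "\<sigma> (f t) = t" if "t \<in> R" for t
    using that f(1) by (simp add: \<sigma>_def)
  have dom_E': "dom E' = f ` R" by (auto simp: E'_def dom_def)
  have E'_f: "\<exists>t\<in>R. Y = f t \<and> r = rename_targets f (head t)" if "E' Y = Some r" for Y r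
    using that f(1) by (auto simp: E'_def split: if_splits)
  \<comment> \<open>Proved for both theories: the conclusion needs ACP, while RSP is applied to
    \<open>E'\<close> within SI_ACP. The right-hand sides are already guarded, so no rewriting is
    involved.\<close>
  have guarded_E': "guarded_spec P T E'" for T
    unfolding guarded_spec_def
  proof (intro allI impI)
    fix Y r assume "E' Y = Some r"
    then obtain t where t: "t \<in> R" "r = rename_targets f (head t)" using E'_f by blast
    note h = hnf_rename_targets[OF head(1)[OF closed_R[OF t(1)]], where f = f, folded t(2)]
    have "vars r \<subseteq> dom E'" using h(3) succ[OF t(1)] dom_E' by blast
    with h(1,2) show "is_term T r \<and> vars r \<subseteq> dom E' \<and>
        (\<exists>g. (rewrite_step P T E' Y)\<^sup>*\<^sup>* r g \<and> is_term T g \<and> guarded g \<and> vars g \<subseteq> dom E')"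
      by blast
  qed
  have X: "X \<in> spec_vars E'"
    using start f(2) dom_E' by (force simp: spec_vars_guarded[OF guarded_E'])
  have "derivable P SI_ACP (\<sigma> X) (Rec X E')"
  proof (rule derivable.RSP[OF guarded_E' X])
    fix Y show "is_rec_term P SI_ACP (\<sigma> Y)"
      using closed_is_rec closed_R inv_into_into[of Y f R] by (auto simp: \<sigma>_def is_rec_term_def)
  next
    fix Y r assume "E' Y = Some r"
    then obtain t where t: "t \<in> R" "Y = f t" "r = rename_targets f (head t)" using E'_f by blast
    \<comment> \<open>All targets of \<open>head t\<close> lie in \<open>R\<close>, where \<sigma>
      undoes \<open>f\<close>; the equation for \<open>t\<close> thus becomes the derivable identity
      of \<open>t\<close> and its head.\<close>
    have "subst \<sigma> r = head t"
      unfolding t(3) using succ[OF t(1)] \<sigma>_f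
      by (intro subst_rename_targets[OF head(1)[OF closed_R[OF t(1)]]]) blast
    then show "derivable P SI_ACP (\<sigma> Y) (subst \<sigma> r)"
      using head(2)[OF closed_R[OF t(1)]] \<sigma>_f[OF t(1)] t(2) by simp
  qed
  then show ?thesis
    using guarded_E' X \<sigma>_f[OF start] f(2) by metis
qed

end

theorem theorem1:
  fixes P :: "('a, 's, 'd) params" and E :: "('a, 's) rspec" and X :: var
  assumes "siacp_params P"
    and "guarded_spec P SI_ACP E"
    and "X \<in> spec_vars E"
  shows "\<exists>E'. guarded_spec P ACP E' \<and> X \<in> spec_vars E' \<and>
    derivable P SI_ACP (Rec X E) (Rec X E')"
proof -
  interpret si_spec P E using assms(1,2) by unfold_locales
  show ?thesis
    using acp_spec_exists assms(3) spec_vars_guarded[OF assms(2)] by simp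
qed

end
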